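(* Let $K$ be a field, let $G$ be a group, let $A=\bigoplus_{g\in G}A_g$ be a finite-dimensional $G$-graded $K$-algebra with a homogeneous basis $(e_i)_{i\in J}$, where $J=\bigcup_{g\in G}J_g$ (disjoint union) and $(e_i)_{i\in J_g}$ is a basis of $A_g$ for each $g\in G$, and let $(c_{ij\ell})_{i,j,\ell\in J}$ be the associated structure constants, so that $e_ie_j=\sum_{\ell\in J}c_{ij\ell}e_\ell$ for all $i,j\in J$. Let $\sigma\in G$. Then $A$ is $\sigma$-graded Frobenius if and only if there exists a family of scalars $\alpha=(\alpha_\ell)_{\ell\in J_\sigma}$ in $K$ such that the $\sigma$-paratrophic matrix $P(\sigma,\alpha)$ is invertible.
   Context: Algebras are associative and unital over the field $K$. A $G$-grading on $A$ is a decomposition $A=\bigoplus_{g\in G}A_g$ into subspaces with $A_gA_h\subseteq A_{gh}$ for all $g,h\in G$. If $A_g=0$, then $J_g=\emptyset$. The $\sigma$-paratrophic matrix $P(\sigma,\alpha)\in M_J(K)$ is the matrix with rows and columns indexed by $J$ whose $(i,j)$-entry is $\sum_{\ell\in J_\sigma}\alpha_\ell c_{ij\ell}$; a sum indexed by the empty set is $0$. The linear dual $A^*$ is a left $A$-module by $(r\rightharpoonup a^* )(a)=a^*(ar)$ for $r,a\in A$, $a^*\in A^*$. It is a $G$-graded left $A$-module with homogeneous component of degree $g\in G$ $$(A^* )_g=\{a^*\in A^*\mid a^*(A_h)=0\text{ for any }h\neq g^{-1}\}.$$ The shift $A(\sigma)$ is the left $A$-module $A$ with grading $A(\sigma)_g=A_{g\sigma}$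 for $g\in G$. The algebra $A$ is called $\sigma$-graded Frobenius if $A^*\simeq A(\sigma)$ as graded left $A$-modules, i.e. there is an $A$-linear isomorphism preserving degrees. *)

theory Defs
  imports Complex_Main "HOL-Algebra.Group" "HOL-Library.Function_Algebras"
begin

text \<open>
  The class \<open>ring\<close> together with an explicit unit, instead of \<open>ring_1\<close>, keeps the zero algebra,
  which \<open>ring_1\<close> excludes through \<open>0 \<noteq> 1\<close>.
\<close>

locale unital_algebra = vector_space scale
  for scale :: "'k::field \<Rightarrow> 'a::ring \<Rightarrow> 'a" +
  assumes scale_mult_left: "scale k a * b = scale k (a * b)"
    and scale_mult_right: "a * scale k b = scale k (a * b)"
    and unital: "\<exists>u::'a. \<forall>a. u * a = a \<and> a * u = a"

definition finite_dimensional :: "('k::field \<Rightarrow> 'a::ab_group_add \<Rightarrow> 'a) \<Rightarrow> bool" where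
  "finite_dimensional scale \<longleftrightarrow> (\<exists>B. finite B \<and> module.span scale B = UNIV)"

text \<open>
  The last conjunct says that the whole space is the direct sum of the \<open>A g\<close>: every element is in a
  unique way a sum of a finitely supported family with \<open>g\<close>-th member in \<open>A g\<close>. The family is set to
  \<open>0\<close> outside \<open>carrier G\<close> only so that uniqueness can be stated for functions on the type \<open>'g\<close>.
\<close>

definition grading ::
  "('k::field \<Rightarrow> 'a::ring \<Rightarrow> 'a) \<Rightarrow> ('g, 'b) monoid_scheme \<Rightarrow> ('g \<Rightarrow> 'a set) \<Rightarrow> bool" where
  "grading scale G A \<longleftrightarrow>
     (\<forall>g\<in>carrier G. module.subspace scale (A g)) \<and>
     (\<forall>g\<in>carrier G. \<forall>h\<in>carrier G. \<forall>a\<in>A g. \<forall>b\<in>A h. a * b \<in> A (g \<otimes>\<^bsub>G\<^esub> h)) \<and>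
     (\<forall>a. \<exists>!x. (\<forall>g\<in>carrier G. x g \<in> A g) \<and> (\<forall>g. g \<notin> carrier G \<longrightarrow> x g = 0) \<and>
        finite {g. x g \<noteq> 0} \<and> a = (\<Sum>g | x g \<noteq> 0. x g))"

definition homogeneous_basis ::
  "('k::field \<Rightarrow> 'a::ring \<Rightarrow> 'a) \<Rightarrow> ('g, 'b) monoid_scheme \<Rightarrow> ('g \<Rightarrow> 'a set) \<Rightarrow>
   ('g \<Rightarrow> 'i set) \<Rightarrow> ('i \<Rightarrow> 'a) \<Rightarrow> bool" where
  "homogeneous_basis scale G A J e \<longleftrightarrow>
     (\<forall>g\<in>carrier G. \<forall>h\<in>carrier G. g \<noteq> h \<longrightarrow> J g \<inter> J h = {}) \<and>
     (\<forall>g\<in>carrier G. inj_on e (J g) \<and> \<not> module.dependent scale (e ` J g) \<and>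
        module.span scale (e ` J g) = A g)"

definition structure_constants ::
  "('k::field \<Rightarrow> 'a::ring \<Rightarrow> 'a) \<Rightarrow> 'i set \<Rightarrow> ('i \<Rightarrow> 'a) \<Rightarrow> ('i \<Rightarrow> 'i \<Rightarrow> 'i \<Rightarrow> 'k) \<Rightarrow> bool" where
  "structure_constants scale I e c \<longleftrightarrow>
     (\<forall>i\<in>I. \<forall>j\<in>I. e i * e j = (\<Sum>l\<in>I. scale (c i j l) (e l)))"

definition dual :: "('k::field \<Rightarrow> 'a::ring \<Rightarrow> 'a) \<Rightarrow> ('a \<Rightarrow> 'k) set" where
  "dual scale = {f. Vector_Spaces.linear scale (*) f}"

definition dual_action :: "'a::ring \<Rightarrow> ('a \<Rightarrow> 'k) \<Rightarrow> 'a \<Rightarrow> 'k" where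
  "dual_action r f = (\<lambda>a. f (a * r))"

definition dual_component ::
  "('k::field \<Rightarrow> 'a::ring \<Rightarrow> 'a) \<Rightarrow> ('g, 'b) monoid_scheme \<Rightarrow> ('g \<Rightarrow> 'a set) \<Rightarrow> 'g \<Rightarrow>
   ('a \<Rightarrow> 'k) set" where
  "dual_component scale G A g =
     {f \<in> dual scale. \<forall>h\<in>carrier G. h \<noteq> inv\<^bsub>G\<^esub> g \<longrightarrow> (\<forall>a\<in>A h. f a = 0)}"

definition shift :: "('g, 'b) monoid_scheme \<Rightarrow> ('g \<Rightarrow> 'a set) \<Rightarrow> 'g \<Rightarrow> 'g \<Rightarrow> 'a set" where
  "shift G A s g = A (g \<otimes>\<^bsub>G\<^esub> s)"

text \<open>
  A graded left module over the algebra \<open>'a\<close> is given here by its carrier, its action and its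
  homogeneous components. An additive map compatible with the action of a unital algebra is
  automatically \<open>K\<close>-linear, since scalars act through multiples of the unit.
\<close>

definition graded_module_isomorphic ::
  "('g, 'b) monoid_scheme \<Rightarrow>
   'm::ab_group_add set \<Rightarrow> ('a \<Rightarrow> 'm \<Rightarrow> 'm) \<Rightarrow> ('g \<Rightarrow> 'm set) \<Rightarrow>
   'n::ab_group_add set \<Rightarrow> ('a \<Rightarrow> 'n \<Rightarrow> 'n) \<Rightarrow> ('g \<Rightarrow> 'n set) \<Rightarrow> bool" where
  "graded_module_isomorphic G M actM compM N actN compN \<longleftrightarrow>
     (\<exists>\<phi>. bij_betw \<phi> M N \<and>
        (\<forall>x\<in>M. \<forall>y\<in>M. \<phi> (x + y) = \<phi> x + \<phi> y) \<and>
        (\<forall>r. \<forall>x\<in>M. \<phi> (actM r x) = actN r (\<phi> x)) \<and>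
        (\<forall>g\<in>carrier G. \<phi> ` compM g \<subseteq> compN g))"

definition graded_Frobenius ::
  "('k::field \<Rightarrow> 'a::ring \<Rightarrow> 'a) \<Rightarrow> ('g, 'b) monoid_scheme \<Rightarrow> ('g \<Rightarrow> 'a set) \<Rightarrow> 'g \<Rightarrow> bool" where
  "graded_Frobenius scale G A s \<longleftrightarrow>
     graded_module_isomorphic G
       (dual scale) dual_action (dual_component scale G A)
       UNIV (*) (shift G A s)"

definition paratrophic ::
  "('g \<Rightarrow> 'i set) \<Rightarrow> ('i \<Rightarrow> 'i \<Rightarrow> 'i \<Rightarrow> 'k::field) \<Rightarrow> 'g \<Rightarrow> ('i \<Rightarrow> 'k) \<Rightarrow> 'i \<Rightarrow> 'i \<Rightarrow> 'k" where
  "paratrophic J c s \<alpha> i j = (\<Sum>l\<in>J s. \<alpha> l * c i j l)"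

text \<open>
  Invertibility in the ring of square matrices with rows and columns indexed by the finite set \<open>I\<close>;
  entries outside \<open>I\<close> play no role. A finite index type would not allow \<open>I\<close> to be empty.
\<close>

definition invertible_on :: "'i set \<Rightarrow> ('i \<Rightarrow> 'i \<Rightarrow> 'k::field) \<Rightarrow> bool" where
  "invertible_on I P \<longleftrightarrow>
     (\<exists>Q. \<forall>i\<in>I. \<forall>j\<in>I.
        (\<Sum>l\<in>I. P i l * Q l j) = (if i = j then 1 else 0) \<and>
        (\<Sum>l\<in>I. Q i l * P l j) = (if i = j then 1 else 0))"

end

theory Submission
  imports Defs
begin

text \<open>
  A linear functional \<open>f\<close> on \<open>A\<close> gives the module homomorphism \<open>r \<mapsto> r \<rightharpoonup> f\<close> from \<open>A\<close> to its
  dual, where \<open>(r \<rightharpoonup> f) a = f (a * r)\<close>; since \<open>A\<close> is unital, every homomorphism from \<open>A\<close> to the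
  dual has this form, \<open>f\<close> being the image of the unit. The unit has degree \<open>\<one>\<close>, that is, degree
  \<open>inv \<sigma>\<close> in the shifted module \<open>A(\<sigma>)\<close>. Hence a graded isomorphism of the dual with \<open>A(\<sigma>)\<close>
  amounts to a functional \<open>f\<close> in the component of degree \<open>inv \<sigma>\<close> of the dual, i.e. one that
  vanishes on every \<open>A h\<close> with \<open>h \<noteq> \<sigma>\<close>, such that \<open>r \<mapsto> r \<rightharpoonup> f\<close> is bijective
  (\<open>graded_Frobenius_imp_functional\<close> and \<open>functional_imp_graded_Frobenius\<close>).

  With respect to the homogeneous basis \<open>e\<close> and its dual basis, this map has the matrix
  \<open>f (e i * e j)\<close>, so that it is bijective iff the matrix is invertible
  (\<open>bij_dual_action_iff_invertible\<close>). A functional of degree \<open>inv \<sigma>\<close> is determined by its values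
  \<open>\<alpha> l = f (e l)\<close> for \<open>l \<in> J \<sigma>\<close>, and these are arbitrary (\<open>homogeneous_functional_ex\<close>). Expanding
  \<open>e i * e j\<close> in the basis turns \<open>f (e i * e j)\<close> into the entry of the paratrophic matrix for
  \<open>\<alpha>\<close> (\<open>paratrophic_eq_functional\<close>).
\<close>


section \<open>The dual space\<close>

context unital_algebra
begin

lemma dual_iff:
  "f \<in> dual scale \<longleftrightarrow>
    (\<forall>a b. f (a + b) = f a + f b) \<and> (\<forall>k a. f (scale k a) = k * f a)"
proof -
  have "vector_space ((*) :: 'k \<Rightarrow> 'k \<Rightarrow> 'k)"
    by unfold_locales (auto simp: algebra_simps)
  then show ?thesis
    unfolding dual_def Vector_Spaces.linear_def module_hom_def module_hom_axioms_def
    using vector_space_axioms module_axioms by (auto simp: module_iff_vector_space)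
qed

lemma dual_add: "f \<in> dual scale \<Longrightarrow> f (a + b) = f a + f b"
  and dual_scale: "f \<in> dual scale \<Longrightarrow> f (scale k a) = k * f a"
  by (auto simp: dual_iff)

lemma dual_zero: "f \<in> dual scale \<Longrightarrow> f 0 = 0"
  using dual_scale[of f 0 0] by simp

lemma dual_sum: "f \<in> dual scale \<Longrightarrow> f (\<Sum>x\<in>S. t x) = (\<Sum>x\<in>S. f (t x))"
  by (induction S rule: infinite_finite_induct) (auto simp: dual_zero dual_add)

lemma dual_sum_closed:
  "(\<And>x. x \<in> S \<Longrightarrow> t x \<in> dual scale) \<Longrightarrow> (\<lambda>a. \<Sum>x\<in>S. t x a) \<in> dual scale"
  by (auto simp: dual_iff sum.distrib sum_distrib_left)

lemma dual_action_closed: "f \<in> dual scale \<Longrightarrow> dual_action r f \<in> dual scale"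
  by (auto simp: dual_iff dual_action_def distrib_right scale_mult_left)

lemma dual_action_add:
  "f \<in> dual scale \<Longrightarrow> dual_action (r + s) f = dual_action r f + dual_action s f"
  by (auto simp: dual_action_def distrib_left dual_add fun_eq_iff)

end

lemma dual_action_mult: "dual_action (r * s) f = dual_action r (dual_action s f)"
  by (simp add: dual_action_def mult.assoc)


section \<open>Homogeneous components\<close>

text \<open>A unital algebra, possibly zero and of arbitrary dimension, graded by a group.\<close>

locale graded_algebra = group G + unital_algebra scale
  for G :: "('g, 'b) monoid_scheme" (structure)
    and scale :: "'k::field \<Rightarrow> 'a::ring \<Rightarrow> 'a" +
  fixes A :: "'g \<Rightarrow> 'a set"
  assumes grading: "grading scale G A"
begin

lemma subspace_A: "g \<in> carrier G \<Longrightarrow> subspace (A g)"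
  using grading by (simp add: grading_def)

lemma mult_A:
  "g \<in> carrier G \<Longrightarrow> h \<in> carrier G \<Longrightarrow> a \<in> A g \<Longrightarrow> b \<in> A h \<Longrightarrow> a * b \<in> A (g \<otimes> h)"
  using grading by (simp add: grading_def)

text \<open>
  The homogeneous component of degree \<open>g\<close> of \<open>a\<close>, as the value at \<open>g\<close> of the unique
  homogeneous family that sums up to \<open>a\<close>. It is \<open>0\<close> when \<open>g\<close> is outside the group.
\<close>

definition component :: "'g \<Rightarrow> 'a \<Rightarrow> 'a" where
  "component g a = (THE x. (\<forall>g\<in>carrier G. x g \<in> A g) \<and> (\<forall>g. g \<notin> carrier G \<longrightarrow> x g = 0) \<and>
     finite {g. x g \<noteq> 0} \<and> a = (\<Sum>g | x g \<noteq> 0. x g)) g"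

abbreviation supp :: "'a \<Rightarrow> 'g set" where
  "supp a \<equiv> {g. component g a \<noteq> 0}"

lemma decomposition_ex1:
  "\<exists>!x. (\<forall>g\<in>carrier G. x g \<in> A g) \<and> (\<forall>g. g \<notin> carrier G \<longrightarrow> x g = 0) \<and>
     finite {g. x g \<noteq> 0} \<and> a = (\<Sum>g | x g \<noteq> 0. x g)"
  using grading unfolding grading_def by blast

lemma component_spec:
  "(\<forall>g\<in>carrier G. component g a \<in> A g) \<and> (\<forall>g. g \<notin> carrier G \<longrightarrow> component g a = 0) \<and>
     finite (supp a) \<and> a = (\<Sum>g\<in>supp a. component g a)"
  using theI'[OF decomposition_ex1[of a]] unfolding component_def .

lemma component_in: "g \<in> carrier G \<Longrightarrow> component g a \<in> A g"
  and component_outside: "g \<notin> carrier G \<Longrightarrow> component g a = 0"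
  and finite_supp: "finite (supp a)"
  and supp_subset: "supp a \<subseteq> carrier G"
  and supp_in: "component g a \<noteq> 0 \<Longrightarrow> g \<in> carrier G"
  using component_spec[of a] by auto

lemma sum_component:
  assumes "finite S" "supp a \<subseteq> S"
  shows "(\<Sum>g\<in>S. component g a) = a"
proof -
  have "(\<Sum>g\<in>S. component g a) = (\<Sum>g\<in>supp a. component g a)"
    using assms by (intro sum.mono_neutral_right) auto
  then show ?thesis using component_spec[of a] by simp
qed

lemma component_unique:
  assumes S: "finite S" "S \<subseteq> carrier G" and x: "\<And>g. g \<in> S \<Longrightarrow> x g \<in> A g"
    and a: "a = (\<Sum>g\<in>S. x g)"
  shows "component g a = (if g \<in> S then x g else 0)"
proof -
  let ?y = "\<lambda>g. if g \<in> S then x g else 0"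
  have sub: "{g. ?y g \<noteq> 0} \<subseteq> S" by auto
  have "(\<Sum>g | ?y g \<noteq> 0. ?y g) = (\<Sum>g\<in>S. ?y g)"
    using S(1) by (intro sum.mono_neutral_left) auto
  also have "\<dots> = a" using a by simp
  finally have y4: "a = (\<Sum>g | ?y g \<noteq> 0. ?y g)" ..
  have y1: "\<forall>g\<in>carrier G. ?y g \<in> A g"
    using x subspace_0[OF subspace_A] by simp
  have y2: "\<forall>g. g \<notin> carrier G \<longrightarrow> ?y g = 0" using S(2) by auto
  have y3: "finite {g. ?y g \<noteq> 0}" using sub S(1) by (rule finite_subset)
  have "(\<lambda>g. component g a) = ?y"
    unfolding component_def
    using the1_equality[OF decomposition_ex1[of a], of ?y, OF conjI[OF y1 conjI[OF y2 conjI[OF y3 y4]]]]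
    by (simp only:)
  then show ?thesis by (rule fun_cong)
qed

lemma component_homogeneous:
  assumes "h \<in> carrier G" "a \<in> A h"
  shows "component g a = (if g = h then a else 0)"
  using component_unique[of "{h}" "\<lambda>_. a" a g] assms by simp

lemma component_add: "component g (a + b) = component g a + component g b"
proof -
  let ?S = "supp a \<union> supp b"
  have "a + b = (\<Sum>g\<in>?S. component g a + component g b)"
    using finite_supp sum_component[of ?S a] sum_component[of ?S b]
    by (simp add: sum.distrib)
  then have "component g (a + b) = (if g \<in> ?S then component g a + component g b else 0)"
  proof (rule component_unique[where x = "\<lambda>g. component g a + component g b", rotated 3])
    show "component g a + component g b \<in> A g" if "g \<in> ?S" for g
      using that supp_in by (blast intro: subspace_add[OF subspace_A] component_in)
  qed (use finite_supp supp_subset in auto)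
  then show ?thesis by auto
qed

lemma component_scale: "component g (scale k a) = scale k (component g a)"
proof -
  have "scale k a = scale k (\<Sum>g\<in>supp a. component g a)"
    using finite_supp by (simp add: sum_component)
  then have "scale k a = (\<Sum>g\<in>supp a. scale k (component g a))"
    by (simp only: scale_sum_right)
  then have "component g (scale k a) = (if g \<in> supp a then scale k (component g a) else 0)"
  proof (rule component_unique[where x = "\<lambda>g. scale k (component g a)", rotated 3])
    show "scale k (component g a) \<in> A g" if "g \<in> supp a" for g
      using that supp_in by (blast intro: subspace_scale[OF subspace_A] component_in)
  qed (use finite_supp supp_subset in auto)
  then show ?thesis by auto
qed

lemma component_zero: "component g 0 = 0"
  using component_add[of g 0 0] by simp

lemma component_sum: "component g (\<Sum>x\<in>S. t x) = (\<Sum>x\<in>S. component g (t x))"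
  by (induction S rule: infinite_finite_induct) (auto simp: component_zero component_add)

text \<open>Left multiplication by an element of degree \<open>g\<close> shifts all components by \<open>g\<close>.\<close>

lemma component_mult:
  assumes g: "g \<in> carrier G" and h: "h \<in> carrier G" and a: "a \<in> A g"
  shows "component (g \<otimes> h) (a * b) = a * component h b"
proof -
  let ?S = "(\<otimes>) g ` supp b"
  have inj: "inj_on ((\<otimes>) g) (supp b)"
    using supp_subset g by (auto simp: inj_on_def subset_iff)
  have cancel: "inv\<^bsub>G\<^esub> g \<otimes> (g \<otimes> k) = k" if "k \<in> carrier G" for k
    using g that by (simp flip: m_assoc)
  have "a * b = a * (\<Sum>k\<in>supp b. component k b)"
    using finite_supp by (simp add: sum_component)
  also have "\<dots> = (\<Sum>k\<in>supp b. a * component k b)" by (rule sum_distrib_left)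
  also have "\<dots> = (\<Sum>k\<in>?S. a * component (inv\<^bsub>G\<^esub> g \<otimes> k) b)"
    unfolding sum.reindex[OF inj] using supp_subset cancel
    by (intro sum.cong) (auto simp: subset_iff)
  finally have "component (g \<otimes> h) (a * b) =
      (if g \<otimes> h \<in> ?S then a * component (inv\<^bsub>G\<^esub> g \<otimes> (g \<otimes> h)) b else 0)"
  proof (rule component_unique[where x = "\<lambda>k. a * component (inv\<^bsub>G\<^esub> g \<otimes> k) b", rotated 3])
    fix k assume "k \<in> ?S"
    then obtain l where l: "l \<in> carrier G" "k = g \<otimes> l" using supp_in by blast
    then show "a * component (inv\<^bsub>G\<^esub> g \<otimes> k) b \<in> A k"
      using mult_A[OF g l(1) a component_in[OF l(1)]] by (simp add: cancel)
  next
    show "?S \<subseteq> carrier G" using supp_in g by blast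
  qed (use finite_supp in auto)
  also have "g \<otimes> h \<in> ?S \<longleftrightarrow> h \<in> supp b"
    using supp_subset[of b] g h by (auto simp: subset_iff)
  finally show ?thesis using cancel[OF h] by auto
qed

text \<open>If \<open>u\<close> is the unit and \<open>v\<close> its component of degree \<open>\<one>\<close>, then comparing components in
  \<open>a * u = a\<close> for homogeneous \<open>a\<close> gives \<open>a * v = a\<close>; at \<open>a = u\<close> this is \<open>v = u\<close>.\<close>

lemma unit_homogeneous:
  assumes u: "\<And>a. u * a = a" "\<And>a. a * u = a"
  shows "u \<in> A \<one>"
proof -
  let ?v = "component \<one> u"
  have hom: "a * ?v = a" if "a \<in> A g" "g \<in> carrier G" for a g
    using component_mult[of g \<one> a u] component_homogeneous[of g a g] u that by simp
  have "u = (\<Sum>g\<in>supp u. component g u)"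
    using finite_supp by (simp add: sum_component)
  also have "\<dots> = (\<Sum>g\<in>supp u. component g u * ?v)"
  proof (intro sum.cong refl)
    fix g assume "g \<in> supp u"
    then have "g \<in> carrier G" using supp_in by blast
    then show "component g u = component g u * ?v"
      using hom[OF component_in] by metis
  qed
  also have "\<dots> = u * ?v"
    using finite_supp by (simp add: sum_component flip: sum_distrib_right)
  finally show ?thesis using u(1) component_in[of \<one> u] by simp
qed

text \<open>Only finitely many degrees occur in a finite-dimensional graded algebra: those of the
  components of a finite spanning set.\<close>

lemma finite_degrees:
  assumes "finite_dimensional scale"
  obtains S where "finite S" "\<And>a. supp a \<subseteq> S"
proof -
  obtain B where B: "finite B" "span B = UNIV"
    using assms by (auto simp: finite_dimensional_def)
  let ?S = "\<Union>b\<in>B. supp b"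
  have "supp a \<subseteq> ?S" for a
  proof -
    have "a \<in> span B" using B by simp
    then show ?thesis
    proof (induction rule: span_induct_alt)
      case base
      then show ?case by (simp add: component_zero)
    next
      case (step c x y)
      then show ?case by (auto simp: component_add component_scale)
    qed
  qed
  then show thesis using that[of ?S] B(1) finite_supp by simp
qed


section \<open>Frobenius functionals\<close>

lemma dual_component_vanish:
  "f \<in> dual_component scale G A g \<Longrightarrow> h \<in> carrier G \<Longrightarrow> h \<noteq> inv\<^bsub>G\<^esub> g \<Longrightarrow> a \<in> A h \<Longrightarrow> f a = 0"
  by (auto simp: dual_component_def)

text \<open>
  A functional of degree \<open>inv g\<close> in the dual only sees the component of degree \<open>g\<close> of its
  argument; conversely, composing any functional with the projection to that component gives one of degree
  \<open>inv g\<close>.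
\<close>

lemma dual_component_apply:
  assumes f: "f \<in> dual_component scale G A (inv\<^bsub>G\<^esub> g)" and g: "g \<in> carrier G"
  shows "f (component g a) = f a"
proof -
  have fd: "f \<in> dual scale" using f by (simp add: dual_component_def)
  have "f a = f (\<Sum>h\<in>insert g (supp a). component h a)"
    using finite_supp by (subst sum_component) auto
  also have "\<dots> = (\<Sum>h\<in>insert g (supp a). f (component h a))" by (rule dual_sum[OF fd])
  also have "\<dots> = (\<Sum>h\<in>{g}. f (component h a))"
  proof (intro sum.mono_neutral_right ballI)
    fix h assume "h \<in> insert g (supp a) - {g}"
    then have "h \<in> carrier G" "h \<noteq> g" using supp_in by auto
    then show "f (component h a) = 0"
      using dual_component_vanish[OF f, of h] component_in g by simp
  qed (use finite_supp in auto)
  finally show ?thesis by simp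
qed

lemma comp_component_in_dual_component:
  assumes "f \<in> dual scale" "g \<in> carrier G"
  shows "(\<lambda>a. f (component g a)) \<in> dual_component scale G A (inv\<^bsub>G\<^esub> g)"
  using assms
  by (auto simp: dual_component_def dual_iff component_add component_scale
      component_homogeneous dual_zero)

text \<open>
  An isomorphism \<open>\<phi>\<close> from the dual to the regular module is inverse to \<open>r \<mapsto> r \<rightharpoonup> f\<close>, where
  \<open>f\<close> is the preimage of the unit. That \<open>f\<close> is homogeneous does not follow at once, because
  \<open>\<phi>\<close> is only assumed to map each component of the dual into, not onto, a component of the
  shift. Therefore a preimage \<open>f0\<close> of the unit is split into its homogeneous parts
  \<open>F g\<close>; as the unit is homogeneous, the part \<open>F s\<close> alone is mapped to it.
\<close>

lemma graded_Frobenius_imp_functional: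
  assumes fd: "finite_dimensional scale" and s: "s \<in> carrier G"
    and Frob: "graded_Frobenius scale G A s"
  obtains f where "f \<in> dual_component scale G A (inv\<^bsub>G\<^esub> s)"
    and "bij_betw (\<lambda>r. dual_action r f) UNIV (dual scale)"
proof -
  obtain \<phi> where bij: "bij_betw \<phi> (dual scale) (UNIV :: 'a set)"
    and hom: "(\<forall>x\<in>dual scale. \<forall>y\<in>dual scale. \<phi> (x + y) = \<phi> x + \<phi> y) \<and>
      (\<forall>r. \<forall>x\<in>dual scale. \<phi> (dual_action r x) = r * \<phi> x) \<and>
      (\<forall>g\<in>carrier G. \<phi> ` dual_component scale G A g \<subseteq> A (g \<otimes> s))"
    using Frob unfolding graded_Frobenius_def graded_module_isomorphic_def shift_def
    by (elim exE conjE) simp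
  have add: "\<phi> (x + y) = \<phi> x + \<phi> y" if "x \<in> dual scale" "y \<in> dual scale" for x y
    using hom that by simp
  have act: "\<phi> (dual_action r x) = r * \<phi> x" if "x \<in> dual scale" for r x
    using hom that by simp
  have deg: "\<phi> x \<in> A (g \<otimes> s)" if "g \<in> carrier G" "x \<in> dual_component scale G A g" for g x
    using hom that by (simp add: image_subset_iff)
  obtain u :: 'a where u: "\<And>a. u * a = a" "\<And>a. a * u = a" using unital by blast
  obtain f0 where f0: "f0 \<in> dual scale" "\<phi> f0 = u"
    using bij by (metis UNIV_I bij_betw_def imageE)
  obtain S0 where S0: "finite S0" "\<And>a. supp a \<subseteq> S0" using finite_degrees[OF fd] by metis
  define S where "S = insert s (S0 \<inter> carrier G)"
  have S: "finite S" "s \<in> S" "S \<subseteq> carrier G" "supp a \<subseteq> S" for a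
    using S0 s supp_subset[of a] by (auto simp: S_def)
  define F where "F = (\<lambda>g a. f0 (component g a))"
  have F: "F g \<in> dual_component scale G A (inv\<^bsub>G\<^esub> g)" if "g \<in> carrier G" for g
    unfolding F_def using comp_component_in_dual_component f0(1) that by blast
  have Fd: "F g \<in> dual scale" if "g \<in> S" for g
    using F that S(3) by (auto simp: dual_component_def)
  have zero: "\<phi> (\<lambda>_. 0) = 0"
    using add[of "\<lambda>_. 0" "\<lambda>_. 0"] by (simp add: dual_iff plus_fun_def)
  have sum: "\<phi> (\<lambda>a. \<Sum>g\<in>T. F g a) = (\<Sum>g\<in>T. \<phi> (F g))" if "finite T" "T \<subseteq> S" for T
    using that
  proof (induction T rule: finite_induct)
    case empty
    then show ?case by (simp add: zero)
  next
    case (insert g T)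
    then have "\<phi> (F g + (\<lambda>a. \<Sum>g\<in>T. F g a)) = \<phi> (F g) + \<phi> (\<lambda>a. \<Sum>g\<in>T. F g a)"
      by (intro add dual_sum_closed Fd) auto
    with insert show ?case by (simp add: plus_fun_def)
  qed
  have "f0 = (\<lambda>a. \<Sum>g\<in>S. F g a)"
  proof
    fix a
    have "f0 a = f0 (\<Sum>g\<in>S. component g a)" using S(1,4) by (simp add: sum_component)
    then show "f0 a = (\<Sum>g\<in>S. F g a)" by (simp add: F_def dual_sum[OF f0(1)])
  qed
  then have "u = (\<Sum>g\<in>S. \<phi> (F g))" using sum[OF S(1)] f0(2) by simp
  then have "component \<one> u = (\<Sum>g\<in>S. component \<one> (\<phi> (F g)))" by (simp add: component_sum)
  \<comment> \<open>\<open>\<phi> (F g)\<close> has degree \<open>inv g \<otimes> s\<close>, which is the degree of the unit only for \<open>g = s\<close>.\<close>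
  also have "\<dots> = (\<Sum>g\<in>S. if g = s then \<phi> (F s) else 0)"
  proof (intro sum.cong refl)
    fix g assume "g \<in> S"
    then have g: "g \<in> carrier G" using S by auto
    have "\<one> = inv\<^bsub>G\<^esub> g \<otimes> s \<longleftrightarrow> g = s"
      using g s by (metis inv_closed inv_equality inv_inv l_inv)
    then show "component \<one> (\<phi> (F g)) = (if g = s then \<phi> (F s) else 0)"
      using component_homogeneous[of "inv\<^bsub>G\<^esub> g \<otimes> s" "\<phi> (F g)" \<one>] deg[OF _ F[OF g]] g s by auto
  qed
  also have "\<dots> = \<phi> (F s)" using S by simp
  finally have \<phi>F: "\<phi> (F s) = u"
    using component_homogeneous[OF _ unit_homogeneous[OF u], of \<one>] by simp
  have Fs: "F s \<in> dual scale" using Fd S by simp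
  have inv1: "\<phi> (dual_action r (F s)) = r" for r
    using act[OF Fs] \<phi>F u by simp
  have inv2: "dual_action (\<phi> x) (F s) = x" if "x \<in> dual scale" for x
    using bij_betw_imp_inj_on[OF bij] inv1[of "\<phi> x"] dual_action_closed[OF Fs] that
    by (auto dest: inj_onD)
  have "bij_betw (\<lambda>r. dual_action r (F s)) UNIV (dual scale)"
    using inv1 inv2 dual_action_closed[OF Fs] by (intro bij_betwI[where g = \<phi>]) auto
  with F[OF s] show thesis by (rule that)
qed

text \<open>
  Conversely, the inverse \<open>\<phi>\<close> of \<open>r \<mapsto> r \<rightharpoonup> f\<close> is a module isomorphism. It preserves degrees since
  a functional \<open>x\<close> of degree \<open>g\<close> only sees the degree \<open>inv g\<close>, and on this degree
  \<open>f (a * \<phi> x)\<close> only depends on the component of \<open>\<phi> x\<close> of degree \<open>g \<otimes> s\<close>.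
\<close>

lemma functional_imp_graded_Frobenius:
  assumes s: "s \<in> carrier G" and f: "f \<in> dual_component scale G A (inv\<^bsub>G\<^esub> s)"
    and bij: "bij_betw (\<lambda>r. dual_action r f) UNIV (dual scale)"
  shows "graded_Frobenius scale G A s"
proof -
  have fd: "f \<in> dual scale" using f by (simp add: dual_component_def)
  define \<phi> where "\<phi> = inv_into UNIV (\<lambda>r. dual_action r f)"
  have inj: "r = t" if "dual_action r f = dual_action t f" for r t
    using bij_betw_imp_inj_on[OF bij] that by (auto dest: injD)
  have \<psi>\<phi>: "dual_action (\<phi> x) f = x" if "x \<in> dual scale" for x
    using bij_betw_inv_into_right[OF bij that] by (simp add: \<phi>_def)
  have "bij_betw \<phi> (dual scale) UNIV"
    unfolding \<phi>_def by (rule bij_betw_inv_into[OF bij])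
  moreover have "\<phi> (x + y) = \<phi> x + \<phi> y" if "x \<in> dual scale" "y \<in> dual scale" for x y
  proof (rule inj)
    have "x + y \<in> dual scale" using that by (auto simp: dual_iff algebra_simps)
    then show "dual_action (\<phi> (x + y)) f = dual_action (\<phi> x + \<phi> y) f"
      using that by (simp add: \<psi>\<phi> dual_action_add[OF fd])
  qed
  moreover have "\<phi> (dual_action r x) = r * \<phi> x" if "x \<in> dual scale" for r x
    using that by (intro inj) (simp add: \<psi>\<phi> dual_action_mult dual_action_closed)
  moreover have "\<phi> x \<in> A (g \<otimes> s)" if g: "g \<in> carrier G" and x: "x \<in> dual_component scale G A g" for g x
  proof -
    have xd: "x \<in> dual scale" using x by (simp add: dual_component_def)
    \<comment> \<open>The component of degree \<open>g \<otimes> s\<close> of \<open>\<phi> x\<close> represents the same functional as \<open>\<phi> x\<close>.\<close>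
    let ?r = "component (g \<otimes> s) (\<phi> x)"
    have r: "?r \<in> A (g \<otimes> s)" using g s by (simp add: component_in)
    have hom: "f (a * ?r) = x a" if a: "a \<in> A h" and h: "h \<in> carrier G" for a h
    proof (cases "h = inv\<^bsub>G\<^esub> g")
      case True
      then have "h \<otimes> (g \<otimes> s) = s" using g s by (simp flip: m_assoc)
      then have "f (a * ?r) = f (component s (a * \<phi> x))"
        using component_mult[of h "g \<otimes> s" a "\<phi> x"] a h g s by simp
      also have "\<dots> = dual_action (\<phi> x) f a"
        using dual_component_apply[OF f s] by (simp add: dual_action_def)
      finally show ?thesis using \<psi>\<phi>[OF xd] by simp
    next
      case False
      then have "h \<otimes> (g \<otimes> s) \<noteq> s"
        using g h s by (metis inv_equality inv_inv m_assoc m_closed l_cancel_one' r_cancel_one')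
      then have "f (a * ?r) = 0"
        using dual_component_vanish[OF f, of "h \<otimes> (g \<otimes> s)"] mult_A[OF h _ a r] g h s by simp
      moreover have "x a = 0" using dual_component_vanish[OF x h False a] .
      ultimately show ?thesis by simp
    qed
    have "dual_action ?r f a = x a" for a
    proof -
      have "dual_action ?r f a = dual_action ?r f (\<Sum>h\<in>supp a. component h a)"
        using finite_supp by (simp add: sum_component)
      also have "\<dots> = (\<Sum>h\<in>supp a. dual_action ?r f (component h a))"
        by (rule dual_sum[OF dual_action_closed[OF fd]])
      also have "\<dots> = (\<Sum>h\<in>supp a. x (component h a))"
        using supp_subset by (intro sum.cong refl) (auto simp: dual_action_def intro!: hom component_in)
      also have "\<dots> = x a"
        using finite_supp by (simp add: sum_component flip: dual_sum[OF xd])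
      finally show ?thesis .
    qed
    then have "?r = \<phi> x" using \<psi>\<phi>[OF xd] by (intro inj) auto
    then show ?thesis using r by simp
  qed
  ultimately show ?thesis
    unfolding graded_Frobenius_def graded_module_isomorphic_def shift_def
    by (intro exI[of _ \<phi>]) blast
qed

end


section \<open>Coordinates with respect to a finite basis\<close>

text \<open>A unital algebra with a finite basis \<open>e\<close> indexed by a set \<open>I\<close>, which may be empty.\<close>

locale based_algebra = unital_algebra scale
  for scale :: "'k::field \<Rightarrow> 'a::ring \<Rightarrow> 'a" +
  fixes I :: "'i set" and e :: "'i \<Rightarrow> 'a"
  assumes finite_I: "finite I" and inj_e: "inj_on e I"
    and independent_e: "independent (e ` I)" and span_e: "span (e ` I) = UNIV"
begin

text \<open>The \<open>i\<close>-th coordinate functional. These functionals form the dual basis; for \<open>i\<close>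
  outside \<open>I\<close> the value has no meaning.\<close>

definition coord :: "'i \<Rightarrow> 'a \<Rightarrow> 'k" where
  "coord i a = representation (e ` I) a (e i)"

lemma coord_dual: "coord i \<in> dual scale"
  using independent_e span_e
  by (simp add: dual_iff coord_def representation_add representation_scale)

lemma coord_basis: "i \<in> I \<Longrightarrow> j \<in> I \<Longrightarrow> coord i (e j) = (if i = j then 1 else 0)"
  using inj_e independent_e by (auto simp: coord_def representation_basis inj_on_eq_iff)

lemma sum_coord: "(\<Sum>i\<in>I. scale (coord i a) (e i)) = a"
proof -
  have "(\<Sum>i\<in>I. scale (coord i a) (e i)) =
      (\<Sum>b\<in>e ` I. scale (representation (e ` I) a b) b)"
    by (simp add: sum.reindex[OF inj_e] coord_def)
  also have "\<dots> = a"
    using independent_e span_e finite_I by (intro sum_representation_eq) auto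
  finally show ?thesis .
qed

lemma dual_coord: "f \<in> dual scale \<Longrightarrow> f a = (\<Sum>i\<in>I. coord i a * f (e i))"
  by (subst (1) sum_coord[of a, symmetric]) (simp add: dual_sum dual_scale)

lemma dual_eqI:
  assumes "f \<in> dual scale" "h \<in> dual scale" "\<And>i. i \<in> I \<Longrightarrow> f (e i) = h (e i)"
  shows "f = h"
proof
  fix a
  show "f a = h a" using assms dual_coord[of f a] dual_coord[of h a] by simp
qed

lemma functional_ex:
  obtains f where "f \<in> dual scale" "\<And>i. i \<in> I \<Longrightarrow> f (e i) = \<alpha> i"
proof
  show "(\<lambda>a. \<Sum>i\<in>I. coord i a * \<alpha> i) \<in> dual scale"
    using coord_dual by (auto simp: dual_iff sum.distrib sum_distrib_left algebra_simps)
  show "(\<Sum>i\<in>I. coord i (e j) * \<alpha> i) = \<alpha> j" if "j \<in> I" for j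
    using that finite_I by (simp add: coord_basis if_distrib[of "\<lambda>x. x * _"] cong: if_cong)
qed

text \<open>
  The matrix of the bilinear form \<open>f (a * b)\<close> is also the matrix of \<open>r \<mapsto> r \<rightharpoonup> f\<close> with respect
  to the given basis and its dual basis.
\<close>

lemma bij_dual_action_iff_invertible:
  assumes f: "f \<in> dual scale"
  shows "bij_betw (\<lambda>r. dual_action r f) UNIV (dual scale) \<longleftrightarrow>
    invertible_on I (\<lambda>i j. f (e i * e j))"
proof
  assume bij: "bij_betw (\<lambda>r. dual_action r f) UNIV (dual scale)"
  \<comment> \<open>The \<open>j\<close>-th column of the inverse holds the coordinates of the element that represents
    the \<open>j\<close>-th coordinate functional.\<close>
  define q where "q j = inv_into UNIV (\<lambda>r. dual_action r f) (coord j)" for j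
  have q: "dual_action (q j) f = coord j" for j
    using bij_betw_inv_into_right[OF bij coord_dual] by (simp add: q_def)
  have fq: "f (a * q j) = coord j a" for a j
    using fun_cong[OF q[of j], of a] by (simp add: dual_action_def)
  have right: "(\<Sum>l\<in>I. f (e i * e l) * coord l (q j)) = (if i = j then 1 else 0)"
    if "i \<in> I" "j \<in> I" for i j
  proof -
    have "f (e i * q j) = f (e i * (\<Sum>l\<in>I. scale (coord l (q j)) (e l)))"
      by (simp add: sum_coord)
    also have "\<dots> = (\<Sum>l\<in>I. f (e i * e l) * coord l (q j))"
      by (simp add: sum_distrib_left scale_mult_right dual_sum[OF f] dual_scale[OF f] mult.commute)
    finally show ?thesis using that by (cases "i = j") (simp_all add: fq coord_basis)
  qed
  have left: "(\<Sum>l\<in>I. coord i (q l) * f (e l * e j)) = (if i = j then 1 else 0)"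
    if "i \<in> I" "j \<in> I" for i j
  proof -
    let ?r = "\<Sum>l\<in>I. scale (f (e l * e j)) (q l)"
    have "dual_action ?r f = dual_action (e j) f"
    proof
      fix a
      have "f (a * ?r) = (\<Sum>l\<in>I. f (e l * e j) * coord l a)"
        by (simp add: sum_distrib_left scale_mult_right dual_sum[OF f] dual_scale[OF f] fq)
      also have "\<dots> = f (a * e j)"
        using dual_coord[OF dual_action_closed[OF f], of "e j" a]
        by (simp add: dual_action_def mult.commute)
      finally show "dual_action ?r f a = dual_action (e j) f a" by (simp add: dual_action_def)
    qed
    then have "?r = e j" using bij_betw_imp_inj_on[OF bij] by (auto dest: injD)
    then have "coord i ?r = coord i (e j)" by simp
    then show ?thesis
      using that by (simp add: dual_sum[OF coord_dual] dual_scale[OF coord_dual] coord_basis mult.commute)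
  qed
  show "invertible_on I (\<lambda>i j. f (e i * e j))"
    unfolding invertible_on_def by (rule exI[of _ "\<lambda>l j. coord l (q j)"]) (simp add: left right)
next
  assume "invertible_on I (\<lambda>i j. f (e i * e j))"
  then obtain Q where right: "\<And>i j. i \<in> I \<Longrightarrow> j \<in> I \<Longrightarrow>
        (\<Sum>l\<in>I. f (e i * e l) * Q l j) = (if i = j then 1 else 0)"
    and left: "\<And>i j. i \<in> I \<Longrightarrow> j \<in> I \<Longrightarrow>
        (\<Sum>l\<in>I. Q i l * f (e l * e j)) = (if i = j then 1 else 0)"
    unfolding invertible_on_def by blast
  \<comment> \<open>The inverse matrix applied to the coordinates of \<open>x\<close> in the dual basis, which are its
    values on the basis.\<close>
  define \<phi> where "\<phi> x = (\<Sum>l\<in>I. scale (\<Sum>i\<in>I. Q l i * x (e i)) (e l))" for x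
  have f_mult: "f (a * \<phi> x) = (\<Sum>i\<in>I. (\<Sum>l\<in>I. f (a * e l) * Q l i) * x (e i))" for a x
  proof -
    have "f (a * \<phi> x) = (\<Sum>l\<in>I. \<Sum>i\<in>I. f (a * e l) * Q l i * x (e i))"
      by (simp add: \<phi>_def sum_distrib_left sum_distrib_right scale_mult_right dual_sum[OF f]
          dual_scale[OF f] mult_ac)
    also have "\<dots> = (\<Sum>i\<in>I. \<Sum>l\<in>I. f (a * e l) * Q l i * x (e i))" by (rule sum.swap)
    finally show ?thesis by (simp add: sum_distrib_right)
  qed
  have \<psi>\<phi>: "dual_action (\<phi> x) f = x" if x: "x \<in> dual scale" for x
  proof (rule dual_eqI[OF dual_action_closed[OF f] x])
    fix k assume "k \<in> I"
    then show "dual_action (\<phi> x) f (e k) = x (e k)"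
      using finite_I
      by (simp add: dual_action_def f_mult right if_distrib[of "\<lambda>x. x * _"] cong: if_cong)
  qed
  have \<phi>\<psi>: "\<phi> (dual_action r f) = r" for r
  proof -
    have "(\<Sum>i\<in>I. Q l i * f (e i * r)) = coord l r" if l: "l \<in> I" for l
    proof -
      have "f (e i * r) = (\<Sum>m\<in>I. f (e i * e m) * coord m r)" for i
        by (subst (1) sum_coord[of r, symmetric])
          (simp add: sum_distrib_left scale_mult_right dual_sum[OF f] dual_scale[OF f] mult.commute)
      then have "(\<Sum>i\<in>I. Q l i * f (e i * r)) =
          (\<Sum>i\<in>I. \<Sum>m\<in>I. Q l i * f (e i * e m) * coord m r)"
        by (simp add: sum_distrib_left mult.assoc)
      also have "\<dots> = (\<Sum>m\<in>I. \<Sum>i\<in>I. Q l i * f (e i * e m) * coord m r)" by (rule sum.swap)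
      also have "\<dots> = (\<Sum>m\<in>I. (if l = m then 1 else 0) * coord m r)"
        using l by (intro sum.cong) (simp_all add: left flip: sum_distrib_right)
      also have "\<dots> = coord l r"
        using l finite_I by (simp add: if_distrib[of "\<lambda>x. x * _"] cong: if_cong)
      finally show ?thesis .
    qed
    then show ?thesis by (simp add: \<phi>_def dual_action_def sum_coord)
  qed
  show "bij_betw (\<lambda>r. dual_action r f) UNIV (dual scale)"
    using \<psi>\<phi> \<phi>\<psi> dual_action_closed[OF f] by (intro bij_betwI[where g = \<phi>]) auto
qed

end


section \<open>Homogeneous bases\<close>

context graded_algebra
begin

lemma homogeneous_basis_in:
  assumes "homogeneous_basis scale G A J e" "g \<in> carrier G" "i \<in> J g"
  shows "e i \<in> A g"
  using assms span_base[of "e i" "e ` J g"] by (auto simp: homogeneous_basis_def)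

text \<open>The homogeneous bases of the \<open>A g\<close> together form a basis of the whole algebra. The component
  maps reduce linear dependences to a single \<open>A g\<close>; finite dimension makes the index set
  finite.\<close>

lemma homogeneous_basis_based_algebra:
  assumes fd: "finite_dimensional scale" and hb: "homogeneous_basis scale G A J e"
  shows "based_algebra scale (\<Union>g\<in>carrier G. J g) e"
proof -
  let ?I = "\<Union>g\<in>carrier G. J g"
  have ind: "independent (e ` J g)" and inj: "inj_on e (J g)" and sp: "span (e ` J g) = A g"
    if "g \<in> carrier G" for g
    using hb that by (auto simp: homogeneous_basis_def)
  note in_A = homogeneous_basis_in[OF hb]
  have comp_e: "component g (e i) = (if g = h then e i else 0)"
    if "i \<in> J h" "h \<in> carrier G" for g h i
    using component_homogeneous in_A that by blast
  have nz: "e i \<noteq> 0" if "i \<in> J g" "g \<in> carrier G" for g i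
    using ind[of g] that dependent_zero by (metis imageI)
  have inj_I: "inj_on e ?I"
  proof (rule inj_onI)
    fix i j assume "i \<in> ?I" "j \<in> ?I" and eq: "e i = e j"
    then obtain g h where gh: "g \<in> carrier G" "i \<in> J g" "h \<in> carrier G" "j \<in> J h" by blast
    have "g = h" using comp_e[of i g g] comp_e[of j h g] gh nz eq by (auto split: if_splits)
    then show "i = j" using inj gh eq by (auto dest: inj_onD)
  qed
  have ind_I: "independent (e ` ?I)"
  proof
    assume "dependent (e ` ?I)"
    then obtain T w v where T: "finite T" "T \<subseteq> e ` ?I" "(\<Sum>v\<in>T. scale (w v) v) = 0"
      and v: "v \<in> T" "w v \<noteq> 0"
      unfolding dependent_explicit by blast
    obtain g i where g: "g \<in> carrier G" "i \<in> J g" "v = e i" using T v by blast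
    let ?U = "T \<inter> e ` J g"
    have "0 = component g (\<Sum>v\<in>T. scale (w v) v)" by (simp add: T component_zero)
    also have "\<dots> = (\<Sum>v\<in>T. scale (w v) (component g v))"
      by (simp add: component_sum component_scale)
    also have "\<dots> = (\<Sum>v\<in>?U. scale (w v) (component g v))"
    proof (intro sum.mono_neutral_right ballI)
    fix v assume v: "v \<in> T - ?U"
    then obtain h i where "h \<in> carrier G" "i \<in> J h" "v = e i" using T(2) by blast
    with v have "component g v = 0" using comp_e[of i h g] by auto
    then show "scale (w v) (component g v) = 0" by simp
  qed (use T(1) in auto)
    also have "\<dots> = (\<Sum>v\<in>?U. scale (w v) v)"
      using comp_e g by (intro sum.cong refl) auto
    finally have "(\<Sum>v\<in>?U. scale (w v) v) = 0" ..
    then have "dependent (e ` J g)"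
      unfolding dependent_explicit using T(1) v g by (intro exI[of _ ?U] exI[of _ w]) auto
    then show False using ind g by blast
  qed
  have "a \<in> span (e ` ?I)" for a
  proof -
    have "component g a \<in> span (e ` ?I)" if "g \<in> supp a" for g
      using that component_in[of g a] sp[of g] supp_subset[of a] span_mono[of "e ` J g" "e ` ?I"]
      by (auto simp: subset_iff)
    then have "(\<Sum>g\<in>supp a. component g a) \<in> span (e ` ?I)" by (rule span_sum)
    then show ?thesis using finite_supp by (simp add: sum_component)
  qed
  then have span_I: "span (e ` ?I) = UNIV" by auto
  obtain B where "finite B" "span B = UNIV" using fd by (auto simp: finite_dimensional_def)
  then have "finite (e ` ?I)" using independent_span_bound[of B] ind_I by auto
  then have "finite ?I" using inj_I finite_imageD by blast
  then show ?thesis using inj_I ind_I span_I by unfold_locales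
qed

lemma paratrophic_eq_functional:
  assumes fd: "finite_dimensional scale" and hb: "homogeneous_basis scale G A J e"
    and sc: "structure_constants scale (\<Union>g\<in>carrier G. J g) e c"
    and s: "s \<in> carrier G" and f: "f \<in> dual_component scale G A (inv\<^bsub>G\<^esub> s)"
    and \<alpha>: "\<And>l. l \<in> J s \<Longrightarrow> f (e l) = \<alpha> l"
    and ij: "i \<in> (\<Union>g\<in>carrier G. J g)" "j \<in> (\<Union>g\<in>carrier G. J g)"
  shows "f (e i * e j) = paratrophic J c s \<alpha> i j"
proof -
  let ?I = "\<Union>g\<in>carrier G. J g"
  interpret based_algebra scale ?I e by (rule homogeneous_basis_based_algebra[OF fd hb])
  have f': "f \<in> dual scale" using f by (simp add: dual_component_def)
  have "e i * e j = (\<Sum>l\<in>?I. scale (c i j l) (e l))"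
    using sc ij unfolding structure_constants_def by blast
  then have "f (e i * e j) = (\<Sum>l\<in>?I. c i j l * f (e l))"
    by (simp add: dual_sum[OF f'] dual_scale[OF f'])
  \<comment> \<open>Only basis elements of degree \<open>s\<close> contribute.\<close>
  also have "\<dots> = (\<Sum>l\<in>J s. c i j l * f (e l))"
  proof (intro sum.mono_neutral_right finite_I ballI)
    show "J s \<subseteq> ?I" using s by blast
    fix l assume "l \<in> ?I - J s"
    then obtain h where "h \<in> carrier G" "l \<in> J h" "h \<noteq> s" by blast
    then have "f (e l) = 0"
      using dual_component_vanish[OF f, of h] homogeneous_basis_in[OF hb] s by simp
    then show "c i j l * f (e l) = 0" by simp
  qed
  finally show ?thesis by (simp add: paratrophic_def \<alpha> mult.commute)
qed

lemma homogeneous_functional_ex: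
  assumes fd: "finite_dimensional scale" and hb: "homogeneous_basis scale G A J e"
    and s: "s \<in> carrier G"
  obtains f where "f \<in> dual_component scale G A (inv\<^bsub>G\<^esub> s)" "\<And>l. l \<in> J s \<Longrightarrow> f (e l) = \<alpha> l"
proof -
  interpret based_algebra scale "\<Union>g\<in>carrier G. J g" e
    by (rule homogeneous_basis_based_algebra[OF fd hb])
  obtain f where f: "f \<in> dual scale" "\<And>i. i \<in> (\<Union>g\<in>carrier G. J g) \<Longrightarrow> f (e i) = \<alpha> i"
    using functional_ex[of \<alpha>] by blast
  have "f (component s (e l)) = \<alpha> l" if "l \<in> J s" for l
    using component_homogeneous[OF s homogeneous_basis_in[OF hb s that], of s] f(2)[of l] s that
    by auto
  with comp_component_in_dual_component[OF f(1) s] show thesis by (rule that)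
qed

end


section \<open>The paratrophic criterion\<close>

lemma invertible_on_cong:
  assumes "\<And>i j. i \<in> I \<Longrightarrow> j \<in> I \<Longrightarrow> P i j = R i j"
  shows "invertible_on I P \<longleftrightarrow> invertible_on I R"
  using assms unfolding invertible_on_def by (simp cong: sum.cong)

theorem propositionB:
  fixes scale :: "'k::field \<Rightarrow> 'a::ring \<Rightarrow> 'a"
    and G :: "('g, 'b) monoid_scheme"
    and A :: "'g \<Rightarrow> 'a set"
    and J :: "'g \<Rightarrow> 'i set"
    and e :: "'i \<Rightarrow> 'a"
    and c :: "'i \<Rightarrow> 'i \<Rightarrow> 'i \<Rightarrow> 'k"
    and \<sigma> :: 'g
  assumes "group G"
    and "unital_algebra scale"
    and "finite_dimensional scale"
    and "grading scale G A"
    and "homogeneous_basis scale G A J e"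
    and "structure_constants scale (\<Union>g\<in>carrier G. J g) e c"
    and "\<sigma> \<in> carrier G"
  shows "graded_Frobenius scale G A \<sigma> \<longleftrightarrow>
    (\<exists>\<alpha> :: 'i \<Rightarrow> 'k. invertible_on (\<Union>g\<in>carrier G. J g) (paratrophic J c \<sigma> \<alpha>))"
proof -
  let ?I = "\<Union>g\<in>carrier G. J g"
  interpret graded_algebra G scale A
    using assms by (intro graded_algebra.intro graded_algebra_axioms.intro)
  interpret based_algebra scale ?I e
    by (rule homogeneous_basis_based_algebra) fact+
  have key: "bij_betw (\<lambda>r. dual_action r f) UNIV (dual scale) \<longleftrightarrow>
      invertible_on ?I (paratrophic J c \<sigma> \<alpha>)"
    if f: "f \<in> dual_component scale G A (inv\<^bsub>G\<^esub> \<sigma>)" and \<alpha>: "\<And>l. l \<in> J \<sigma> \<Longrightarrow> f (e l) = \<alpha> l"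
    for f \<alpha>
  proof -
    have "f \<in> dual scale" using f by (simp add: dual_component_def)
    moreover have "invertible_on ?I (\<lambda>i j. f (e i * e j)) \<longleftrightarrow>
        invertible_on ?I (paratrophic J c \<sigma> \<alpha>)"
      by (rule invertible_on_cong, rule paratrophic_eq_functional) (use assms f \<alpha> in auto)
    ultimately show ?thesis using bij_dual_action_iff_invertible by blast
  qed
  show ?thesis
  proof
    assume "graded_Frobenius scale G A \<sigma>"
    then obtain f where "f \<in> dual_component scale G A (inv\<^bsub>G\<^esub> \<sigma>)"
      and "bij_betw (\<lambda>r. dual_action r f) UNIV (dual scale)"
      using graded_Frobenius_imp_functional assms by blast
    then show "\<exists>\<alpha>. invertible_on ?I (paratrophic J c \<sigma> \<alpha>)"
      using key[of f "\<lambda>l. f (e l)"] by blast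
  next
    assume "\<exists>\<alpha>. invertible_on ?I (paratrophic J c \<sigma> \<alpha>)"
    then obtain \<alpha> where \<alpha>: "invertible_on ?I (paratrophic J c \<sigma> \<alpha>)" ..
    obtain f where f: "f \<in> dual_component scale G A (inv\<^bsub>G\<^esub> \<sigma>)" "\<And>l. l \<in> J \<sigma> \<Longrightarrow> f (e l) = \<alpha> l"
      using homogeneous_functional_ex[of J e \<sigma> \<alpha>] assms by blast
    then show "graded_Frobenius scale G A \<sigma>"
      using functional_imp_graded_Frobenius[OF _ f(1)] key[OF f] \<alpha> assms by blast
  qed
qed

end
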